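(* Let $S$ be a set. The functors $\mathrm{Fun}_{\mathrm{Mon}}(S,\_)$ and $\mathrm{Fun}_{\mathrm{Semir}^\dagger}(S,\_)$ commute with $\mathcal F_{\mathrm{OMon}}$, in the sense that $$\mathcal F_{(S,\mathrm{OMon}^+)}\circ\mathrm{Fun}_{\mathrm{Mon}}(S,\_)=\mathrm{Fun}_{\mathrm{Semir}^\dagger}(S,\_)\circ\mathcal F_{\mathrm{OMon}}$$ as functors on $\mathrm{OMon}^+$.
   Context: All monoids are commutative. A semiring$^\dagger$ is a semiring with multiplicative unit but not necessarily with zero; $\mathrm{Semir}^\dagger$ is the category of semirings$^\dagger$ with homomorphisms preserving $+$, $\cdot$, $1$; $\mathrm{Mon}$ is the category of monoids. $\mathrm{OMon}^+$ is the category of cancellative totally ordered monoids ($b\le c\Rightarrow ab\le ac$) with order-preserving monoid homomorphisms. $\mathcal F_{\mathrm{OMon}}$ sends a totally ordered monoid $\mathcal M$ to the bipotent semiring$^\dagger$ with the same multiplication and with $a+b:=\max\{a,b\}$, and sends an order-preserving monoid homomorphism to the same map viewed as a semiring$^\dagger$ homomorphism. For a monoid (resp. semiring$^\dagger$) $\mathcal M$, $\mathrm{Fun}(S,\mathcal M)$ is the set of functions $S\to\mathcal M$ with pointwise multiplication (resp. pointwise multiplication and addition). $\mathrm{Fun}_{\mathrm{Mon}}(S,\_):\mathrm{Mon}\to\mathrm{Mon}$ and $\mathrm{Fun}_{\mathrm{Semir}^\dagger}(S,\_):\mathrm{Semir}^\dagger\to\mathrm{Semir}^\dagger$ are the functors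 sending $\mathcal M\mapsto\mathrm{Fun}(S,\mathcal M)$ and sending a morphism $\varphi$ to $f\mapsto\varphi\circ f$. When $\mathcal M$ is ordered, $\mathrm{Fun}(S,\mathcal M)$ is partially ordered pointwise. $\mathrm{Fun}(S,\mathrm{OMon}^+)$ and $\mathrm{Fun}(S,\mathrm{Semir}^\dagger)$ denote the images of $\mathrm{OMon}^+$ and $\mathrm{Semir}^\dagger$ under these functors. $\mathcal F_{(S,\mathrm{OMon}^+)}:\mathrm{Fun}(S,\mathrm{OMon}^+)\to\mathrm{Fun}(S,\mathrm{Semir}^\dagger)$ is the functor sending $\mathrm{Fun}(S,\mathcal M)$ to $\mathrm{Fun}(S,\mathcal M)$ with $\mathcal M$ viewed as the semiring$^\dagger$ $\mathcal F_{\mathrm{OMon}}(\mathcal M)$, and sending the morphism induced by $\varphi:\mathcal M\to\mathcal M'$ to $f\mapsto\varphi\circ f$. *)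

theory Defs
  imports "HOL-Algebra.Group"
begin

section \<open>Categories and functors\<close>

record ('o, 'm) precategory =
  Obj :: "'o set"
  Arr :: "'m set"
  Dom :: "'m \<Rightarrow> 'o"
  Cod :: "'m \<Rightarrow> 'o"
  Id :: "'o \<Rightarrow> 'm"
  Comp :: "'m \<Rightarrow> 'm \<Rightarrow> 'm"  \<comment> \<open>\<open>Comp C g f\<close> is "g after f"\<close>

locale category =
  fixes C :: "('o, 'm) precategory"
  assumes dom_cod: "f \<in> Arr C \<Longrightarrow> Dom C f \<in> Obj C \<and> Cod C f \<in> Obj C"
    and id: "A \<in> Obj C \<Longrightarrow> Id C A \<in> Arr C \<and> Dom C (Id C A) = A \<and> Cod C (Id C A) = A"
    and comp: "\<lbrakk>f \<in> Arr C; g \<in> Arr C; Cod C f = Dom C g\<rbrakk> \<Longrightarrow>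
      Comp C g f \<in> Arr C \<and> Dom C (Comp C g f) = Dom C f \<and> Cod C (Comp C g f) = Cod C g"
    and id_left: "f \<in> Arr C \<Longrightarrow> Comp C (Id C (Cod C f)) f = f"
    and id_right: "f \<in> Arr C \<Longrightarrow> Comp C f (Id C (Dom C f)) = f"
    and assoc: "\<lbrakk>f \<in> Arr C; g \<in> Arr C; h \<in> Arr C; Cod C f = Dom C g; Cod C g = Dom C h\<rbrakk> \<Longrightarrow>
      Comp C h (Comp C g f) = Comp C (Comp C h g) f"

record ('o, 'm, 'p, 'n) prefunctor =
  Src :: "('o, 'm) precategory"
  Tgt :: "('p, 'n) precategory"
  fobj :: "'o \<Rightarrow> 'p"
  farr :: "'m \<Rightarrow> 'n"

text \<open>The two maps are extensional (\<^const>\<open>undefined\<close> off the source category), so that equality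
  of the records is equality of functors.\<close>

definition is_functor :: "('o, 'm, 'p, 'n) prefunctor \<Rightarrow> bool" where
  "is_functor F \<longleftrightarrow> category (Src F) \<and> category (Tgt F) \<and>
     fobj F \<in> Obj (Src F) \<rightarrow>\<^sub>E Obj (Tgt F) \<and> farr F \<in> Arr (Src F) \<rightarrow>\<^sub>E Arr (Tgt F) \<and>
     (\<forall>f \<in> Arr (Src F). Dom (Tgt F) (farr F f) = fobj F (Dom (Src F) f) \<and>
                         Cod (Tgt F) (farr F f) = fobj F (Cod (Src F) f)) \<and>
     (\<forall>A \<in> Obj (Src F). farr F (Id (Src F) A) = Id (Tgt F) (fobj F A)) \<and>
     (\<forall>f \<in> Arr (Src F). \<forall>g \<in> Arr (Src F). Cod (Src F) f = Dom (Src F) g \<longrightarrow>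
        farr F (Comp (Src F) g f) = Comp (Tgt F) (farr F g) (farr F f))"

definition mk_functor :: "('o, 'm) precategory \<Rightarrow> ('p, 'n) precategory \<Rightarrow> ('o \<Rightarrow> 'p) \<Rightarrow> ('m \<Rightarrow> 'n) \<Rightarrow>
    ('o, 'm, 'p, 'n) prefunctor" where
  "mk_functor C D F G = \<lparr>Src = C, Tgt = D, fobj = restrict F (Obj C), farr = restrict G (Arr C)\<rparr>"

definition comp_functor :: "('p, 'n, 'q, 'k) prefunctor \<Rightarrow> ('o, 'm, 'p, 'n) prefunctor \<Rightarrow>
    ('o, 'm, 'q, 'k) prefunctor"  (infixl "\<circ>\<^sub>F" 55) where
  "G \<circ>\<^sub>F F = mk_functor (Src F) (Tgt G) (\<lambda>A. fobj G (fobj F A)) (\<lambda>f. farr G (farr F f))"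

definition restrict_functor :: "('o, 'm, 'p, 'n) prefunctor \<Rightarrow> ('o, 'm) precategory \<Rightarrow>
    ('o, 'm, 'p, 'n) prefunctor" where
  "restrict_functor F C = mk_functor C (Tgt F) (fobj F) (farr F)"

definition image_category :: "('o, 'm, 'p, 'n) prefunctor \<Rightarrow> ('p, 'n) precategory" where
  "image_category F = (Tgt F)\<lparr>Obj := fobj F ` Obj (Src F), Arr := farr F ` Arr (Src F)\<rparr>"

definition onto_image :: "('o, 'm, 'p, 'n) prefunctor \<Rightarrow> ('o, 'm, 'p, 'n) prefunctor" where
  "onto_image F = F\<lparr>Tgt := image_category F\<rparr>"

text \<open>A category of structured sets: \<open>P A B f\<close> says that the map \<open>f\<close> from the carrier of \<open>A\<close> to
  that of \<open>B\<close> preserves the structure.  An arrow is a triple (source, map, target).\<close>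

definition concrete_category ::
  "('a, 'r) monoid_scheme set \<Rightarrow>
   (('a, 'r) monoid_scheme \<Rightarrow> ('a, 'r) monoid_scheme \<Rightarrow> ('a \<Rightarrow> 'a) \<Rightarrow> bool) \<Rightarrow>
   (('a, 'r) monoid_scheme, ('a, 'r) monoid_scheme \<times> ('a \<Rightarrow> 'a) \<times> ('a, 'r) monoid_scheme) precategory"
  where
  "concrete_category Ob P =
     \<lparr>Obj = Ob,
      Arr = {(A, f, B). A \<in> Ob \<and> B \<in> Ob \<and> f \<in> carrier A \<rightarrow>\<^sub>E carrier B \<and> P A B f},
      Dom = (\<lambda>(A, f, B). A),
      Cod = (\<lambda>(A, f, B). B),
      Id = (\<lambda>A. (A, \<lambda>x\<in>carrier A. x, A)),
      Comp = (\<lambda>(B', g, C) (A, f, B). (A, compose (carrier A) g f, C))\<rparr>"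

section \<open>Monoids, ordered monoids and semirings without zero\<close>

record 'a ord_monoid = "'a monoid" +
  ord_rel :: "'a rel"  \<comment> \<open>\<open>(a, b) \<in> ord_rel M\<close> means \<open>a \<le> b\<close>\<close>

record 'a semiring_dag = "'a monoid" +
  sadd :: "'a \<Rightarrow> 'a \<Rightarrow> 'a"  (infixl "\<oplus>\<^sup>\<dagger>\<index>" 65)

locale po_monoid = comm_monoid M for M :: "'a ord_monoid" (structure) +
  assumes partial_order: "partial_order_on (carrier M) (ord_rel M)"
    and mult_mono: "\<lbrakk>a \<in> carrier M; (b, c) \<in> ord_rel M\<rbrakk> \<Longrightarrow> (a \<otimes> b, a \<otimes> c) \<in> ord_rel M"

locale to_monoid = po_monoid +
  assumes linear_order: "linear_order_on (carrier M) (ord_rel M)"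

locale cancel_to_monoid = to_monoid +
  assumes cancel: "\<lbrakk>a \<in> carrier M; b \<in> carrier M; c \<in> carrier M; a \<otimes> b = a \<otimes> c\<rbrakk> \<Longrightarrow> b = c"

locale semiring_dag = comm_monoid R for R :: "'a semiring_dag" (structure) +
  assumes add_closed: "\<lbrakk>a \<in> carrier R; b \<in> carrier R\<rbrakk> \<Longrightarrow> a \<oplus>\<^sup>\<dagger> b \<in> carrier R"
    and add_assoc: "\<lbrakk>a \<in> carrier R; b \<in> carrier R; c \<in> carrier R\<rbrakk> \<Longrightarrow>
      (a \<oplus>\<^sup>\<dagger> b) \<oplus>\<^sup>\<dagger> c = a \<oplus>\<^sup>\<dagger> (b \<oplus>\<^sup>\<dagger> c)"
    and add_commute: "\<lbrakk>a \<in> carrier R; b \<in> carrier R\<rbrakk> \<Longrightarrow> a \<oplus>\<^sup>\<dagger> b = b \<oplus>\<^sup>\<dagger> a"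
    and distrib: "\<lbrakk>a \<in> carrier R; b \<in> carrier R; c \<in> carrier R\<rbrakk> \<Longrightarrow>
      a \<otimes> (b \<oplus>\<^sup>\<dagger> c) = (a \<otimes> b) \<oplus>\<^sup>\<dagger> (a \<otimes> c)"

definition monoid_map :: "('a, 'r) monoid_scheme \<Rightarrow> ('a, 'r) monoid_scheme \<Rightarrow> ('a \<Rightarrow> 'a) \<Rightarrow> bool" where
  "monoid_map M N f \<longleftrightarrow> f \<in> hom M N \<and> f \<one>\<^bsub>M\<^esub> = \<one>\<^bsub>N\<^esub>"

definition ord_monoid_map :: "'a ord_monoid \<Rightarrow> 'a ord_monoid \<Rightarrow> ('a \<Rightarrow> 'a) \<Rightarrow> bool" where
  "ord_monoid_map M N f \<longleftrightarrow> monoid_map M N f \<and> (\<forall>(a, b) \<in> ord_rel M. (f a, f b) \<in> ord_rel N)"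

definition semiring_dag_map :: "'a semiring_dag \<Rightarrow> 'a semiring_dag \<Rightarrow> ('a \<Rightarrow> 'a) \<Rightarrow> bool" where
  "semiring_dag_map M N f \<longleftrightarrow> monoid_map M N f \<and>
     (\<forall>a \<in> carrier M. \<forall>b \<in> carrier M. f (a \<oplus>\<^sup>\<dagger>\<^bsub>M\<^esub> b) = f a \<oplus>\<^sup>\<dagger>\<^bsub>N\<^esub> f b)"

definition Mon :: "('a monoid, 'a monoid \<times> ('a \<Rightarrow> 'a) \<times> 'a monoid) precategory" where
  "Mon = concrete_category {M. comm_monoid M} monoid_map"

type_synonym 'a ord_category =
  "('a ord_monoid, 'a ord_monoid \<times> ('a \<Rightarrow> 'a) \<times> 'a ord_monoid) precategory"

type_synonym 'a semir_category =
  "('a semiring_dag, 'a semiring_dag \<times> ('a \<Rightarrow> 'a) \<times> 'a semiring_dag) precategory"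

definition POMon :: "'a ord_category" where
  "POMon = concrete_category {M. po_monoid M} ord_monoid_map"

definition OMon :: "'a ord_category" where
  "OMon = concrete_category {M. to_monoid M} ord_monoid_map"

definition OMon_plus :: "'a ord_category" where
  "OMon_plus = concrete_category {M. cancel_to_monoid M} ord_monoid_map"

definition Semir :: "'a semir_category" where
  "Semir = concrete_category {R. semiring_dag R} semiring_dag_map"

section \<open>The functor from ordered monoids to bipotent semirings\<close>

definition bipotent :: "'a ord_monoid \<Rightarrow> 'a semiring_dag" where
  "bipotent M = \<lparr>carrier = carrier M, mult = mult M, one = one M,
     sadd = (\<lambda>a b. if (a, b) \<in> ord_rel M then b else a)\<rparr>"

text \<open>A functor that acts as \<open>\<Phi>\<close> on objects and keeps the map underlying an arrow.\<close>

definition same_map_functor where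
  "same_map_functor C D \<Phi> = mk_functor C D \<Phi> (\<lambda>(M, \<phi>, M'). (\<Phi> M, \<phi>, \<Phi> M'))"

definition F_OMon where
  "F_OMon = same_map_functor OMon Semir bipotent"

section \<open>Function monoids and function semirings\<close>

definition fun_monoid :: "'s set \<Rightarrow> 'a monoid \<Rightarrow> ('s \<Rightarrow> 'a) monoid" where
  "fun_monoid S M = \<lparr>carrier = S \<rightarrow>\<^sub>E carrier M,
     mult = (\<lambda>f g. \<lambda>s\<in>S. f s \<otimes>\<^bsub>M\<^esub> g s), one = (\<lambda>s\<in>S. \<one>\<^bsub>M\<^esub>)\<rparr>"

definition fun_ord_monoid :: "'s set \<Rightarrow> 'a ord_monoid \<Rightarrow> ('s \<Rightarrow> 'a) ord_monoid" where
  "fun_ord_monoid S M = \<lparr>carrier = S \<rightarrow>\<^sub>E carrier M,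
     mult = (\<lambda>f g. \<lambda>s\<in>S. f s \<otimes>\<^bsub>M\<^esub> g s), one = (\<lambda>s\<in>S. \<one>\<^bsub>M\<^esub>),
     ord_rel = {(f, g). f \<in> S \<rightarrow>\<^sub>E carrier M \<and> g \<in> S \<rightarrow>\<^sub>E carrier M \<and> (\<forall>s\<in>S. (f s, g s) \<in> ord_rel M)}\<rparr>"

definition fun_semiring :: "'s set \<Rightarrow> 'a semiring_dag \<Rightarrow> ('s \<Rightarrow> 'a) semiring_dag" where
  "fun_semiring S R = \<lparr>carrier = S \<rightarrow>\<^sub>E carrier R,
     mult = (\<lambda>f g. \<lambda>s\<in>S. f s \<otimes>\<^bsub>R\<^esub> g s), one = (\<lambda>s\<in>S. \<one>\<^bsub>R\<^esub>),
     sadd = (\<lambda>f g. \<lambda>s\<in>S. f s \<oplus>\<^sup>\<dagger>\<^bsub>R\<^esub> g s)\<rparr>"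

definition fun_functor where
  "fun_functor S C D \<Phi> =
     mk_functor C D \<Phi> (\<lambda>(M, \<phi>, M'). (\<Phi> M, \<lambda>f \<in> S \<rightarrow>\<^sub>E carrier M. compose S \<phi> f, \<Phi> M'))"

definition Fun_Mon where
  "Fun_Mon S = fun_functor S Mon Mon (fun_monoid S)"

text \<open>\<open>Fun_POMon S\<close> is \<open>Fun_Mon S\<close> with the pointwise order carried along; see
  \<open>forget_Fun_POMon\<close> below.  The order is needed because the monoid structure of
  \<open>Fun(S,M)\<close> does not determine the semiring structure that \<open>F_Fun S\<close> assigns to it.\<close>

definition Fun_POMon where
  "Fun_POMon S = fun_functor S POMon POMon (fun_ord_monoid S)"

definition Fun_Semir where
  "Fun_Semir S = fun_functor S Semir Semir (fun_semiring S)"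

definition Fun_OMon_plus :: "'s set \<Rightarrow> ('s \<Rightarrow> 'a) ord_category" where
  "Fun_OMon_plus S = image_category (restrict_functor (Fun_POMon S) OMon_plus)"

definition Fun_Semir_cat :: "'s set \<Rightarrow> ('s \<Rightarrow> 'a) semir_category" where
  "Fun_Semir_cat S = image_category (Fun_Semir S)"

text \<open>The value of the functor \<open>F_Fun S\<close> on \<open>Fun(S,M)\<close> is given in terms of \<open>M\<close>, which has to be
  recovered from \<open>Fun(S,M)\<close>; the value does not depend on \<open>M\<close> (\<open>F_Fun_obj_eq\<close> below), even for
  empty \<open>S\<close>, where \<open>M\<close> itself is lost.\<close>

definition F_Fun_obj :: "'s set \<Rightarrow> ('s \<Rightarrow> 'a) ord_monoid \<Rightarrow> ('s \<Rightarrow> 'a) semiring_dag" where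
  "F_Fun_obj S N = (THE R. \<exists>M \<in> Obj OMon_plus. N = fun_ord_monoid S M \<and> R = fun_semiring S (bipotent M))"

definition F_Fun where
  "F_Fun S = same_map_functor (Fun_OMon_plus S) (Fun_Semir_cat S) (F_Fun_obj S)"

definition forget where
  "forget = same_map_functor POMon Mon monoid.truncate"

section \<open>The constructions above are well defined\<close>

lemma mk_functor_simps [simp]:
  "Src (mk_functor C D F G) = C" "Tgt (mk_functor C D F G) = D"
  "A \<in> Obj C \<Longrightarrow> fobj (mk_functor C D F G) A = F A"
  "f \<in> Arr C \<Longrightarrow> farr (mk_functor C D F G) f = G f"
  by (auto simp: mk_functor_def)

lemma is_functor_mkI:
  assumes "category C" "category D"
    and "\<And>A. A \<in> Obj C \<Longrightarrow> F A \<in> Obj D"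
    and "\<And>f. f \<in> Arr C \<Longrightarrow> G f \<in> Arr D \<and> Dom D (G f) = F (Dom C f) \<and> Cod D (G f) = F (Cod C f)"
    and "\<And>A. A \<in> Obj C \<Longrightarrow> G (Id C A) = Id D (F A)"
    and "\<And>f g. \<lbrakk>f \<in> Arr C; g \<in> Arr C; Cod C f = Dom C g\<rbrakk> \<Longrightarrow> G (Comp C g f) = Comp D (G g) (G f)"
  shows "is_functor (mk_functor C D F G)"
  using assms category.dom_cod[OF assms(1)] category.id[OF assms(1)] category.comp[OF assms(1)]
  unfolding is_functor_def mk_functor_def by (auto simp: PiE_iff)

lemma is_functorD:
  assumes "is_functor F"
  shows "category (Src F)" "category (Tgt F)"
    and "A \<in> Obj (Src F) \<Longrightarrow> fobj F A \<in> Obj (Tgt F)"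
    and "f \<in> Arr (Src F) \<Longrightarrow> farr F f \<in> Arr (Tgt F)"
    and "f \<in> Arr (Src F) \<Longrightarrow> Dom (Tgt F) (farr F f) = fobj F (Dom (Src F) f)"
    and "f \<in> Arr (Src F) \<Longrightarrow> Cod (Tgt F) (farr F f) = fobj F (Cod (Src F) f)"
    and "A \<in> Obj (Src F) \<Longrightarrow> farr F (Id (Src F) A) = Id (Tgt F) (fobj F A)"
    and "\<lbrakk>f \<in> Arr (Src F); g \<in> Arr (Src F); Cod (Src F) f = Dom (Src F) g\<rbrakk> \<Longrightarrow>
      farr F (Comp (Src F) g f) = Comp (Tgt F) (farr F g) (farr F f)"
  using assms unfolding is_functor_def by (auto simp: PiE_iff)

lemma is_functor_comp:
  assumes F: "is_functor F" and G: "is_functor G" and FG: "Tgt F = Src G"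
  shows "is_functor (G \<circ>\<^sub>F F)"
  unfolding comp_functor_def
  by (rule is_functor_mkI) (use is_functorD[OF F] is_functorD[OF G] FG in auto)

lemma image_category_simps [simp]:
  "Obj (image_category F) = fobj F ` Obj (Src F)" "Arr (image_category F) = farr F ` Arr (Src F)"
  "Dom (image_category F) = Dom (Tgt F)" "Cod (image_category F) = Cod (Tgt F)"
  "Id (image_category F) = Id (Tgt F)" "Comp (image_category F) = Comp (Tgt F)"
  by (simp_all add: image_category_def)

text \<open>The image of a functor need not be closed under composition.  It is if the functor is injective
  on objects (here: \<open>S\<close> nonempty) or if all arrows have the same image (here: \<open>S\<close> empty).\<close>

lemma category_image:
  assumes F: "is_functor F"
    and inj: "inj_on (fobj F) (Obj (Src F)) \<or>
      (\<forall>f \<in> Arr (Src F). \<forall>g \<in> Arr (Src F). farr F f = farr F g)"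
  shows "category (image_category F)"
proof -
  note Fd = is_functorD[OF F]
  interpret C: category "Src F" by (rule Fd)
  interpret D: category "Tgt F" by (rule Fd)
  have clos: "Comp (Tgt F) (farr F g) (farr F f) \<in> farr F ` Arr (Src F)"
    if f: "f \<in> Arr (Src F)" and g: "g \<in> Arr (Src F)"
      and fg: "Cod (Tgt F) (farr F f) = Dom (Tgt F) (farr F g)" for f g
    using inj
  proof
    assume "inj_on (fobj F) (Obj (Src F))"
    moreover have "fobj F (Cod (Src F) f) = fobj F (Dom (Src F) g)"
      using fg f g by (simp add: Fd)
    ultimately have e: "Cod (Src F) f = Dom (Src F) g"
      using C.dom_cod f g by (meson inj_onD)
    then have "Comp (Tgt F) (farr F g) (farr F f) = farr F (Comp (Src F) g f)"
      using f g by (simp add: Fd)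
    then show ?thesis using C.comp[OF f g e] by auto
  next
    assume a: "\<forall>f \<in> Arr (Src F). \<forall>g \<in> Arr (Src F). farr F f = farr F g"
    let ?i = "Id (Src F) (Dom (Src F) g)"
    have i: "?i \<in> Arr (Src F)" using C.dom_cod[OF g] C.id by auto
    have "farr F f = farr F ?i" using a f i by blast
    also have "\<dots> = Id (Tgt F) (Dom (Tgt F) (farr F g))" using C.dom_cod[OF g] g by (simp add: Fd)
    finally have "Comp (Tgt F) (farr F g) (farr F f) = farr F g"
      using D.id_right Fd(4)[OF g] by simp
    then show ?thesis using g by auto
  qed
  show ?thesis
  proof
    show "Dom (image_category F) f \<in> Obj (image_category F) \<and> Cod (image_category F) f \<in> Obj (image_category F)"
      if "f \<in> Arr (image_category F)" for f
      using that C.dom_cod by (auto simp: Fd)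
    show "Id (image_category F) A \<in> Arr (image_category F) \<and>
        Dom (image_category F) (Id (image_category F) A) = A \<and>
        Cod (image_category F) (Id (image_category F) A) = A"
      if "A \<in> Obj (image_category F)" for A
      using that C.id D.id by (auto simp: Fd simp flip: Fd(7))
    show "Comp (image_category F) g f \<in> Arr (image_category F) \<and>
        Dom (image_category F) (Comp (image_category F) g f) = Dom (image_category F) f \<and>
        Cod (image_category F) (Comp (image_category F) g f) = Cod (image_category F) g"
      if "f \<in> Arr (image_category F)" "g \<in> Arr (image_category F)"
        "Cod (image_category F) f = Dom (image_category F) g" for f g
    proof -
      from that obtain f' g' where fg: "f' \<in> Arr (Src F)" "g' \<in> Arr (Src F)" "f = farr F f'" "g = farr F g'"
        by auto
      have "f \<in> Arr (Tgt F)" "g \<in> Arr (Tgt F)" using fg Fd(4) by auto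
      then show ?thesis using that(3) D.comp clos fg by auto
    qed
    show "Comp (image_category F) (Id (image_category F) (Cod (image_category F) f)) f = f"
      if "f \<in> Arr (image_category F)" for f
      using that D.id_left Fd(4) by auto
    show "Comp (image_category F) f (Id (image_category F) (Dom (image_category F) f)) = f"
      if "f \<in> Arr (image_category F)" for f
      using that D.id_right Fd(4) by auto
    show "Comp (image_category F) h (Comp (image_category F) g f) =
        Comp (image_category F) (Comp (image_category F) h g) f"
      if "f \<in> Arr (image_category F)" "g \<in> Arr (image_category F)" "h \<in> Arr (image_category F)"
        "Cod (image_category F) f = Dom (image_category F) g"
        "Cod (image_category F) g = Dom (image_category F) h" for f g h
      using that D.assoc Fd(4) by auto
  qed
qed

lemma is_functor_onto_image:
  assumes F: "is_functor F" and im: "category (image_category F)"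
  shows "is_functor (onto_image F)"
  using F im unfolding is_functor_def onto_image_def by (auto simp: PiE_iff)

lemma concrete_category_simps:
  "Obj (concrete_category Ob P) = Ob"
  "(A, f, B) \<in> Arr (concrete_category Ob P) \<longleftrightarrow>
     A \<in> Ob \<and> B \<in> Ob \<and> f \<in> carrier A \<rightarrow>\<^sub>E carrier B \<and> P A B f"
  "Dom (concrete_category Ob P) (A, f, B) = A"
  "Cod (concrete_category Ob P) (A, f, B) = B"
  "Id (concrete_category Ob P) A = (A, \<lambda>x\<in>carrier A. x, A)"
  "Comp (concrete_category Ob P) (B', g, C) (A, f, B) = (A, compose (carrier A) g f, C)"
  by (simp_all add: concrete_category_def)

lemma category_concrete:
  assumes "\<And>A. A \<in> Ob \<Longrightarrow> P A A (\<lambda>x\<in>carrier A. x)"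
    and "\<And>A B C f g. \<lbrakk>A \<in> Ob; B \<in> Ob; C \<in> Ob; f \<in> carrier A \<rightarrow>\<^sub>E carrier B;
      g \<in> carrier B \<rightarrow>\<^sub>E carrier C; P A B f; P B C g\<rbrakk> \<Longrightarrow> P A C (compose (carrier A) g f)"
  shows "category (concrete_category Ob P)"
proof
  fix h g f
  assume *: "f \<in> Arr (concrete_category Ob P)" "g \<in> Arr (concrete_category Ob P)"
    "h \<in> Arr (concrete_category Ob P)"
    "Cod (concrete_category Ob P) f = Dom (concrete_category Ob P) g"
    "Cod (concrete_category Ob P) g = Dom (concrete_category Ob P) h"
  obtain A f' B where f: "f = (A, f', B)" by (cases f)
  obtain B' g' C where g: "g = (B', g', C)" by (cases g)
  obtain C' h' D where h: "h = (C', h', D)" by (cases h)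
  have "f' \<in> carrier A \<rightarrow> carrier B" "B' = B"
    using * by (auto simp: f g h concrete_category_simps)
  then show "Comp (concrete_category Ob P) h (Comp (concrete_category Ob P) g f) =
    Comp (concrete_category Ob P) (Comp (concrete_category Ob P) h g) f"
    by (auto simp: f g h concrete_category_simps compose_assoc)
next
  fix f assume *: "f \<in> Arr (concrete_category Ob P)"
  obtain A f' B where f: "f = (A, f', B)" by (cases f)
  have f': "f' \<in> carrier A \<rightarrow>\<^sub>E carrier B" using * by (auto simp: f concrete_category_simps)
  then have "compose (carrier A) (\<lambda>x\<in>carrier B. x) f' = f'" 
    by (auto simp: compose_def fun_eq_iff PiE_iff extensional_def)
  then show "Comp (concrete_category Ob P) (Id (concrete_category Ob P) (Cod (concrete_category Ob P) f)) f = f"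
    by (simp add: f concrete_category_simps)
  have "compose (carrier A) f' (\<lambda>x\<in>carrier A. x) = f'" 
    using f' by (auto simp: compose_def fun_eq_iff PiE_iff extensional_def)
  then show "Comp (concrete_category Ob P) f (Id (concrete_category Ob P) (Dom (concrete_category Ob P) f)) = f"
    by (simp add: f concrete_category_simps)
next
  fix g f
  assume *: "f \<in> Arr (concrete_category Ob P)" "g \<in> Arr (concrete_category Ob P)"
    "Cod (concrete_category Ob P) f = Dom (concrete_category Ob P) g"
  obtain A f' B where f: "f = (A, f', B)" by (cases f)
  obtain B' g' C where g: "g = (B', g', C)" by (cases g)
  have h: "A \<in> Ob" "B \<in> Ob" "C \<in> Ob" "f' \<in> carrier A \<rightarrow>\<^sub>E carrier B"
      "g' \<in> carrier B \<rightarrow>\<^sub>E carrier C" "P A B f'" "P B C g'"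
    using * by (auto simp: f g concrete_category_simps)
  have "compose (carrier A) g' f' \<in> carrier A \<rightarrow>\<^sub>E carrier C" 
    using h(4,5) by (auto simp: compose_def)
  then show "Comp (concrete_category Ob P) g f \<in> Arr (concrete_category Ob P) \<and>
       Dom (concrete_category Ob P) (Comp (concrete_category Ob P) g f) = Dom (concrete_category Ob P) f \<and>
       Cod (concrete_category Ob P) (Comp (concrete_category Ob P) g f) = Cod (concrete_category Ob P) g"
    using h assms(2)[OF h] by (simp add: f g concrete_category_simps)
qed (auto simp: concrete_category_simps assms(1))

lemma monoid_map_id: "monoid A \<Longrightarrow> monoid_map A A (\<lambda>x\<in>carrier A. x)"
  by (auto simp: monoid_map_def hom_def monoid.m_closed monoid.one_closed)

lemma monoid_map_compose:
  assumes "monoid A" "f \<in> carrier A \<rightarrow>\<^sub>E carrier B" "monoid_map A B f" "monoid_map B C g"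
  shows "monoid_map A C (compose (carrier A) g f)"
  using assms
  by (auto simp: monoid_map_def hom_def compose_def monoid.m_closed monoid.one_closed Pi_iff PiE_iff)

lemma po_monoid_ord_carrier:
  "po_monoid M \<Longrightarrow> (a, b) \<in> ord_rel M \<Longrightarrow> a \<in> carrier M \<and> b \<in> carrier M"
  using po_monoid.partial_order by (fastforce simp: partial_order_on_def preorder_on_def)

lemma po_monoid_monoid: "po_monoid M \<Longrightarrow> monoid M"
  by (simp add: po_monoid_def comm_monoid.axioms)

lemma ord_monoid_map_id: "po_monoid A \<Longrightarrow> ord_monoid_map A A (\<lambda>x\<in>carrier A. x)"
  by (auto simp: ord_monoid_map_def monoid_map_id po_monoid_monoid dest: po_monoid_ord_carrier)

lemma ord_monoid_map_compose:
  assumes "po_monoid A" "f \<in> carrier A \<rightarrow>\<^sub>E carrier B" "ord_monoid_map A B f" "ord_monoid_map B C g"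
  shows "ord_monoid_map A C (compose (carrier A) g f)"
proof -
  have "(f a, f b) \<in> ord_rel B" if "(a, b) \<in> ord_rel A" for a b
    using that assms(3) by (auto simp: ord_monoid_map_def)
  moreover have "(g a, g b) \<in> ord_rel C" if "(a, b) \<in> ord_rel B" for a b
    using that assms(4) by (auto simp: ord_monoid_map_def)
  moreover have "monoid_map A C (compose (carrier A) g f)"
    using assms monoid_map_compose[OF po_monoid_monoid[OF assms(1)] assms(2)]
    by (auto simp: ord_monoid_map_def)
  ultimately show ?thesis
    using po_monoid_ord_carrier[OF assms(1)] by (auto simp: ord_monoid_map_def compose_eq)
qed

lemma to_po: "to_monoid M \<Longrightarrow> po_monoid M"
  by (simp add: to_monoid_def)

lemma cancel_to: "cancel_to_monoid M \<Longrightarrow> to_monoid M"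
  by (simp add: cancel_to_monoid_def)

lemma category_Mon: "category Mon"
  unfolding Mon_def
  by (rule category_concrete)
     (auto intro: monoid_map_id monoid_map_compose comm_monoid.axioms)

lemma category_POMon: "category POMon"
  unfolding POMon_def
  by (rule category_concrete) (auto intro: ord_monoid_map_id ord_monoid_map_compose)

lemma category_OMon: "category OMon"
  unfolding OMon_def
  by (rule category_concrete) (auto intro: ord_monoid_map_id ord_monoid_map_compose to_po)

lemma category_OMon_plus: "category OMon_plus"
  unfolding OMon_plus_def
  by (rule category_concrete) (auto intro: ord_monoid_map_id ord_monoid_map_compose to_po cancel_to)

lemma semiring_dag_monoid: "semiring_dag R \<Longrightarrow> monoid R"
  by (simp add: semiring_dag_def comm_monoid.axioms)

lemma category_Semir: "category Semir"
  unfolding Semir_def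
proof (rule category_concrete)
  show "semiring_dag_map A A (\<lambda>x\<in>carrier A. x)" if "A \<in> {R. semiring_dag R}" for A :: "'a semiring_dag"
    using that by (auto simp: semiring_dag_map_def monoid_map_id semiring_dag_monoid semiring_dag.add_closed)
  show "semiring_dag_map A C (compose (carrier A) g f)"
    if "A \<in> {R. semiring_dag R}" "f \<in> carrier A \<rightarrow>\<^sub>E carrier B" "semiring_dag_map A B f" "semiring_dag_map B C g"
    for A B C :: "'a semiring_dag" and f g
    using that monoid_map_compose[OF semiring_dag_monoid that(2)]
    by (auto simp: semiring_dag_map_def compose_def semiring_dag.add_closed PiE_iff)
qed

lemma bipotent_simps [simp]:
  "carrier (bipotent M) = carrier M" "mult (bipotent M) = mult M" "one (bipotent M) = one M"
  "sadd (bipotent M) a b = (if (a, b) \<in> ord_rel M then b else a)"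
  by (simp_all add: bipotent_def)

lemma semiring_bipotent:
  assumes "to_monoid M"
  shows "semiring_dag (bipotent M)"
proof -
  interpret to_monoid M by fact
  have tot: "a \<in> carrier M \<Longrightarrow> b \<in> carrier M \<Longrightarrow> (a, b) \<in> ord_rel M \<or> (b, a) \<in> ord_rel M" for a b
    using linear_order partial_order
    by (cases "a = b") (auto simp: linear_order_on_def total_on_def partial_order_on_def preorder_on_def refl_on_def)
  have tr: "(a, b) \<in> ord_rel M \<Longrightarrow> (b, c) \<in> ord_rel M \<Longrightarrow> (a, c) \<in> ord_rel M" for a b c
    using partial_order by (auto simp: partial_order_on_def preorder_on_def dest: transD)
  have an: "(a, b) \<in> ord_rel M \<Longrightarrow> (b, a) \<in> ord_rel M \<Longrightarrow> a = b" for a b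
    using partial_order by (auto simp: partial_order_on_def dest: antisymD)
  interpret B: comm_monoid "bipotent M"
    by (rule comm_monoidI) (auto simp: m_assoc intro: m_comm)
  show ?thesis
  proof
    fix a b c assume "a \<in> carrier (bipotent M)" "b \<in> carrier (bipotent M)" "c \<in> carrier (bipotent M)"
    then have c: "a \<in> carrier M" "b \<in> carrier M" "c \<in> carrier M" by auto
    show "sadd (bipotent M) (sadd (bipotent M) a b) c = sadd (bipotent M) a (sadd (bipotent M) b c)"
      using tot[OF c(1,2)] tot[OF c(2,3)] tot[OF c(1,3)] tr an by (smt (verit) bipotent_simps(4))
    show "a \<otimes>\<^bsub>bipotent M\<^esub> sadd (bipotent M) b c =
        sadd (bipotent M) (a \<otimes>\<^bsub>bipotent M\<^esub> b) (a \<otimes>\<^bsub>bipotent M\<^esub> c)"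
      using tot[OF c(2,3)] mult_mono[OF c(1), of b c] mult_mono[OF c(1), of c b] an[of "a \<otimes>\<^bsub>M\<^esub> b" "a \<otimes>\<^bsub>M\<^esub> c"]
      by auto
  next
    fix a b assume "a \<in> carrier (bipotent M)" "b \<in> carrier (bipotent M)"
    then have c: "a \<in> carrier M" "b \<in> carrier M" by auto
    show "sadd (bipotent M) a b \<in> carrier (bipotent M)" using c by auto
    show "sadd (bipotent M) a b = sadd (bipotent M) b a" using tot[OF c] an by auto
  qed
qed

lemma bipotent_map:
  assumes "to_monoid M" "to_monoid N" "f \<in> carrier M \<rightarrow>\<^sub>E carrier N" "ord_monoid_map M N f"
  shows "semiring_dag_map (bipotent M) (bipotent N) f"
proof -
  interpret M: to_monoid M by fact
  interpret N: to_monoid N by fact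
  have tot: "a \<in> carrier M \<Longrightarrow> b \<in> carrier M \<Longrightarrow> (a, b) \<in> ord_rel M \<or> (b, a) \<in> ord_rel M" for a b
    using M.linear_order M.partial_order
    by (cases "a = b") (auto simp: linear_order_on_def total_on_def partial_order_on_def preorder_on_def refl_on_def)
  have an: "(a, b) \<in> ord_rel N \<Longrightarrow> (b, a) \<in> ord_rel N \<Longrightarrow> a = b" for a b
    using N.partial_order by (auto simp: partial_order_on_def dest: antisymD)
  have mono: "(a, b) \<in> ord_rel M \<Longrightarrow> (f a, f b) \<in> ord_rel N" for a b
    using assms(4) by (auto simp: ord_monoid_map_def)
  have "monoid_map (bipotent M) (bipotent N) f"
    using assms(4) by (auto simp: ord_monoid_map_def monoid_map_def hom_def)
  then show ?thesis
    using tot an mono by (auto simp: semiring_dag_map_def) blast+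
qed

lemma is_functor_same_map:
  assumes "category (concrete_category Ob P)" "category (concrete_category Ob' P')"
    and "\<And>M. M \<in> Ob \<Longrightarrow> \<Phi> M \<in> Ob' \<and> carrier (\<Phi> M) = carrier M"
    and "\<And>M N f. \<lbrakk>M \<in> Ob; N \<in> Ob; f \<in> carrier M \<rightarrow>\<^sub>E carrier N; P M N f\<rbrakk> \<Longrightarrow> P' (\<Phi> M) (\<Phi> N) f"
  shows "is_functor (same_map_functor (concrete_category Ob P) (concrete_category Ob' P') \<Phi>)"
  unfolding same_map_functor_def
  by (rule is_functor_mkI) (use assms in \<open>auto simp: concrete_category_simps\<close>)

lemma is_functor_F_OMon: "is_functor F_OMon"
  unfolding F_OMon_def OMon_def Semir_def
  by (rule is_functor_same_map)
     (use category_OMon category_Semir semiring_bipotent bipotent_map in \<open>auto simp: OMon_def Semir_def\<close>)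

lemma truncate_simps [simp]:
  "carrier (monoid.truncate M) = carrier M" "mult (monoid.truncate M) = mult M"
  "one (monoid.truncate M) = one M"
  by (simp_all add: monoid.truncate_def)

lemma is_functor_forget: "is_functor forget"
  unfolding forget_def POMon_def Mon_def
proof (rule is_functor_same_map)
  show "monoid.truncate M \<in> {M. comm_monoid M} \<and> carrier (monoid.truncate M) = carrier M"
    if "M \<in> {M. po_monoid M}" for M :: "'a ord_monoid"
  proof -
    interpret po_monoid M using that by simp
    have "comm_monoid (monoid.truncate M)" by (rule comm_monoidI) (auto simp: m_assoc intro: m_comm)
    then show ?thesis by simp
  qed
qed (use category_Mon category_POMon in
     \<open>auto simp: Mon_def POMon_def ord_monoid_map_def monoid_map_def hom_def\<close>)

lemma fun_simps [simp]:
  "carrier (fun_monoid S M) = S \<rightarrow>\<^sub>E carrier M"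
  "mult (fun_monoid S M) f g = (\<lambda>s\<in>S. f s \<otimes>\<^bsub>M\<^esub> g s)" "one (fun_monoid S M) = (\<lambda>s\<in>S. \<one>\<^bsub>M\<^esub>)"
  "carrier (fun_ord_monoid S N) = S \<rightarrow>\<^sub>E carrier N"
  "mult (fun_ord_monoid S N) f g = (\<lambda>s\<in>S. f s \<otimes>\<^bsub>N\<^esub> g s)" "one (fun_ord_monoid S N) = (\<lambda>s\<in>S. \<one>\<^bsub>N\<^esub>)"
  "(f, g) \<in> ord_rel (fun_ord_monoid S N) \<longleftrightarrow>
     f \<in> S \<rightarrow>\<^sub>E carrier N \<and> g \<in> S \<rightarrow>\<^sub>E carrier N \<and> (\<forall>s\<in>S. (f s, g s) \<in> ord_rel N)"
  "carrier (fun_semiring S R) = S \<rightarrow>\<^sub>E carrier R"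
  "mult (fun_semiring S R) f g = (\<lambda>s\<in>S. f s \<otimes>\<^bsub>R\<^esub> g s)" "one (fun_semiring S R) = (\<lambda>s\<in>S. \<one>\<^bsub>R\<^esub>)"
  "sadd (fun_semiring S R) f g = (\<lambda>s\<in>S. f s \<oplus>\<^sup>\<dagger>\<^bsub>R\<^esub> g s)"
  by (simp_all add: fun_monoid_def fun_ord_monoid_def fun_semiring_def)

lemma PiE_ext: "f \<in> S \<rightarrow>\<^sub>E A \<Longrightarrow> g \<in> S \<rightarrow>\<^sub>E A \<Longrightarrow> (\<And>s. s \<in> S \<Longrightarrow> f s = g s) \<Longrightarrow> f = g"
  by (auto intro: extensionalityI simp: PiE_iff)

lemma comm_monoid_pointwise:
  assumes "comm_monoid M"
    and N: "carrier N = S \<rightarrow>\<^sub>E carrier M" "\<And>f g. mult N f g = (\<lambda>s\<in>S. f s \<otimes>\<^bsub>M\<^esub> g s)" "one N = (\<lambda>s\<in>S. \<one>\<^bsub>M\<^esub>)"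
  shows "comm_monoid N"
proof -
  interpret comm_monoid M by fact
  show ?thesis
    by (rule comm_monoidI)
       (auto simp: N PiE_iff m_assoc extensional_def intro!: restrict_ext ext m_comm)
qed

lemma po_fun:
  assumes "po_monoid M"
  shows "po_monoid (fun_ord_monoid S M)"
proof -
  interpret M: po_monoid M by fact
  interpret N: comm_monoid "fun_ord_monoid S M"
    by (rule comm_monoid_pointwise[where M = M and S = S]) (auto intro: M.comm_monoid_axioms)
  have r: "a \<in> carrier M \<Longrightarrow> (a, a) \<in> ord_rel M" for a
    using M.partial_order by (auto simp: partial_order_on_def preorder_on_def refl_on_def)
  have tr: "(a, b) \<in> ord_rel M \<Longrightarrow> (b, c) \<in> ord_rel M \<Longrightarrow> (a, c) \<in> ord_rel M" for a b c
    using M.partial_order by (auto simp: partial_order_on_def preorder_on_def dest: transD)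
  have an: "(a, b) \<in> ord_rel M \<Longrightarrow> (b, a) \<in> ord_rel M \<Longrightarrow> a = b" for a b
    using M.partial_order by (auto simp: partial_order_on_def dest: antisymD)
  show ?thesis
  proof
    show "partial_order_on (carrier (fun_ord_monoid S M)) (ord_rel (fun_ord_monoid S M))"
      unfolding partial_order_on_def preorder_on_def
    proof (intro conjI)
      show "refl_on (carrier (fun_ord_monoid S M)) (ord_rel (fun_ord_monoid S M))"
        by (auto simp: refl_on_def PiE_iff r)
      show "trans (ord_rel (fun_ord_monoid S M))"
        by (rule transI) (auto intro: tr)
      show "antisym (ord_rel (fun_ord_monoid S M))"
        by (rule antisymI) (auto intro!: PiE_ext[of _ S "carrier M"] intro: an)
    qed auto
  qed (auto simp: PiE_iff M.mult_mono)
qed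

lemma semiring_fun:
  assumes "semiring_dag R"
  shows "semiring_dag (fun_semiring S R)"
proof -
  interpret R: semiring_dag R by fact
  interpret N: comm_monoid "fun_semiring S R"
    by (rule comm_monoid_pointwise[where M = R and S = S]) (auto intro: R.comm_monoid_axioms)
  show ?thesis
    by standard
      (auto simp: PiE_iff R.add_closed R.add_assoc R.distrib intro!: restrict_ext intro: R.add_commute)
qed

lemma is_functor_fun:
  assumes cat: "category (concrete_category Ob P)" "category (concrete_category Ob' P')"
    and ob: "\<And>M. M \<in> Ob \<Longrightarrow> \<Phi> M \<in> Ob' \<and> carrier (\<Phi> M) = S \<rightarrow>\<^sub>E carrier M"
    and ar: "\<And>M N f. \<lbrakk>M \<in> Ob; N \<in> Ob; f \<in> carrier M \<rightarrow>\<^sub>E carrier N; P M N f\<rbrakk> \<Longrightarrow>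
      P' (\<Phi> M) (\<Phi> N) (\<lambda>h \<in> S \<rightarrow>\<^sub>E carrier M. compose S f h)"
  shows "is_functor (fun_functor S (concrete_category Ob P) (concrete_category Ob' P') \<Phi>)"
  unfolding fun_functor_def
proof (rule is_functor_mkI[OF cat], goal_cases)
  case (1 A) then show ?case using ob by (auto simp: concrete_category_simps)
next
  case (2 f)
  obtain A f' B where f: "f = (A, f', B)" by (cases f)
  have *: "A \<in> Ob" "B \<in> Ob" "f' \<in> carrier A \<rightarrow>\<^sub>E carrier B" "P A B f'"
    using 2 by (auto simp: concrete_category_simps f)
  have "(\<lambda>h \<in> S \<rightarrow>\<^sub>E carrier A. compose S f' h) \<in> (S \<rightarrow>\<^sub>E carrier A) \<rightarrow>\<^sub>E (S \<rightarrow>\<^sub>E carrier B)"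
    using *(3) by (auto simp: compose_def PiE_iff)
  then show ?case using ob[OF *(1)] ob[OF *(2)] ar[OF *]
    by (simp add: concrete_category_simps f)
next
  case (3 A)
  have "(\<lambda>h \<in> S \<rightarrow>\<^sub>E carrier A. compose S (\<lambda>x\<in>carrier A. x) h) = (\<lambda>h\<in>S \<rightarrow>\<^sub>E carrier A. h)"
    by (rule restrict_ext) (auto simp: compose_def PiE_iff extensional_def fun_eq_iff)
  then show ?case using 3 ob by (simp add: concrete_category_simps)
next
  case (4 f g)
  obtain A f' B where f: "f = (A, f', B)" by (cases f)
  obtain B' g' C where g: "g = (B', g', C)" by (cases g)
  have f': "f' \<in> carrier A \<rightarrow>\<^sub>E carrier B" "B' = B" "A \<in> Ob" using 4 by (auto simp: f g concrete_category_simps)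
  have "(\<lambda>h\<in>S \<rightarrow>\<^sub>E carrier A. compose S (compose (carrier A) g' f') h) =
    compose (S \<rightarrow>\<^sub>E carrier A) (\<lambda>h\<in>S \<rightarrow>\<^sub>E carrier B. compose S g' h) (\<lambda>h\<in>S \<rightarrow>\<^sub>E carrier A. compose S f' h)"
    unfolding compose_def[of "S \<rightarrow>\<^sub>E carrier A"] using f'(1)
    by (intro restrict_ext) (auto simp: compose_def PiE_iff intro!: restrict_ext)
  then show ?case using ob[OF f'(3)] f'(2) by (simp add: concrete_category_simps f g)
qed

lemma monoid_map_fun:
  assumes "monoid M" "monoid_map M N f"
    and M': "carrier M' = S \<rightarrow>\<^sub>E carrier M" "\<And>g h. mult M' g h = (\<lambda>s\<in>S. g s \<otimes>\<^bsub>M\<^esub> h s)"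
      "one M' = (\<lambda>s\<in>S. \<one>\<^bsub>M\<^esub>)"
    and N': "carrier N' = S \<rightarrow>\<^sub>E carrier N" "\<And>g h. mult N' g h = (\<lambda>s\<in>S. g s \<otimes>\<^bsub>N\<^esub> h s)"
      "one N' = (\<lambda>s\<in>S. \<one>\<^bsub>N\<^esub>)"
  shows "monoid_map M' N' (\<lambda>h \<in> S \<rightarrow>\<^sub>E carrier M. compose S f h)"
proof -
  interpret monoid M by fact
  show ?thesis using assms(2)
    by (auto simp: monoid_map_def hom_def M' N' compose_def PiE_iff Pi_iff intro!: restrict_ext)
qed

lemma is_functor_Fun_Mon: "is_functor (Fun_Mon S)"
  unfolding Fun_Mon_def Mon_def
proof (rule is_functor_fun)
  show "fun_monoid S M \<in> {M. comm_monoid M} \<and> carrier (fun_monoid S M) = S \<rightarrow>\<^sub>E carrier M"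
    if "M \<in> {M. comm_monoid M}" for M :: "'a monoid"
    using that comm_monoid_pointwise[of M "fun_monoid S M" S] by auto
  show "monoid_map (fun_monoid S M) (fun_monoid S N) (\<lambda>h \<in> S \<rightarrow>\<^sub>E carrier M. compose S f h)"
    if "M \<in> {M. comm_monoid M}" "monoid_map M N f" for M N :: "'a monoid" and f
    using that by (intro monoid_map_fun[of M N]) (auto intro: comm_monoid.axioms)
qed (use category_Mon in \<open>auto simp: Mon_def\<close>)

lemma is_functor_Fun_POMon: "is_functor (Fun_POMon S)"
  unfolding Fun_POMon_def POMon_def
proof (rule is_functor_fun)
  show "ord_monoid_map (fun_ord_monoid S M) (fun_ord_monoid S N) (\<lambda>h \<in> S \<rightarrow>\<^sub>E carrier M. compose S f h)"
    if "M \<in> {M. po_monoid M}" "f \<in> carrier M \<rightarrow>\<^sub>E carrier N" "ord_monoid_map M N f"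
    for M N :: "'a ord_monoid" and f
  proof -
    have "monoid_map (fun_ord_monoid S M) (fun_ord_monoid S N) (\<lambda>h \<in> S \<rightarrow>\<^sub>E carrier M. compose S f h)"
      using that by (intro monoid_map_fun[of M N]) (auto simp: ord_monoid_map_def intro: po_monoid_monoid)
    then show ?thesis
      using that by (auto simp: ord_monoid_map_def compose_def PiE_iff)
  qed
qed (use category_POMon po_fun in \<open>auto simp: POMon_def\<close>)

lemma is_functor_Fun_Semir: "is_functor (Fun_Semir S)"
  unfolding Fun_Semir_def Semir_def
proof (rule is_functor_fun)
  show "semiring_dag_map (fun_semiring S M) (fun_semiring S N) (\<lambda>h \<in> S \<rightarrow>\<^sub>E carrier M. compose S f h)"
    if "M \<in> {M. semiring_dag M}" "f \<in> carrier M \<rightarrow>\<^sub>E carrier N" "semiring_dag_map M N f"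
    for M N :: "'a semiring_dag" and f
  proof -
    interpret semiring_dag M using that by simp
    have "monoid_map (fun_semiring S M) (fun_semiring S N) (\<lambda>h \<in> S \<rightarrow>\<^sub>E carrier M. compose S f h)"
      using that by (intro monoid_map_fun[of M N]) (auto simp: semiring_dag_map_def intro: semiring_dag_monoid)
    then show ?thesis
      using that by (auto simp: semiring_dag_map_def compose_def PiE_iff add_closed intro!: restrict_ext)
  qed
qed (use category_Semir semiring_fun in \<open>auto simp: Semir_def\<close>)

lemma forget_Fun_POMon: "forget \<circ>\<^sub>F Fun_POMon S = Fun_Mon S \<circ>\<^sub>F forget"
proof -
  have ob: "monoid.truncate (fun_ord_monoid S M) = fun_monoid S (monoid.truncate M)" for M
    by (simp add: monoid.truncate_def fun_ord_monoid_def fun_monoid_def)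
  note F = is_functorD[OF is_functor_Fun_POMon[of S]] and U = is_functorD[OF is_functor_forget]
  have [simp]: "Src (Fun_POMon S) = POMon" "Tgt (Fun_POMon S) = POMon" "Src (Fun_Mon S) = Mon"
      "Tgt (Fun_Mon S) = Mon" "Src forget = POMon" "Tgt forget = Mon"
    by (simp_all add: Fun_POMon_def Fun_Mon_def forget_def same_map_functor_def fun_functor_def)
  have "fobj forget (fobj (Fun_POMon S) A) = fobj (Fun_Mon S) (fobj forget A)" if "A \<in> Obj POMon" for A
    using that F(3)[of A] U(3)[of A] ob
    by (simp add: Fun_POMon_def Fun_Mon_def forget_def same_map_functor_def fun_functor_def)
  moreover have "farr forget (farr (Fun_POMon S) f) = farr (Fun_Mon S) (farr forget f)" if "f \<in> Arr POMon" for f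
    using that F(4)[of f] U(4)[of f] ob[of "fst f"] ob[of "snd (snd f)"]
    by (cases f) (simp add: Fun_POMon_def Fun_Mon_def forget_def same_map_functor_def fun_functor_def)
  ultimately show ?thesis
    unfolding comp_functor_def mk_functor_def by (auto intro!: restrict_ext)
qed

lemma OMon_plus_sub:
  "M \<in> Obj OMon_plus \<Longrightarrow> M \<in> Obj OMon" "M \<in> Obj OMon_plus \<Longrightarrow> M \<in> Obj POMon"
  "f \<in> Arr OMon_plus \<Longrightarrow> f \<in> Arr OMon" "f \<in> Arr OMon_plus \<Longrightarrow> f \<in> Arr POMon"
  by (auto simp: OMon_plus_def OMon_def POMon_def concrete_category_def intro: to_po cancel_to)

lemma is_functor_restrict:
  assumes F: "is_functor F" and C: "category C"
    and sub: "Obj C \<subseteq> Obj (Src F)" "Arr C \<subseteq> Arr (Src F)"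
      "Dom C = Dom (Src F)" "Cod C = Cod (Src F)" "Id C = Id (Src F)" "Comp C = Comp (Src F)"
  shows "is_functor (restrict_functor F C)"
  unfolding restrict_functor_def
  by (rule is_functor_mkI)
    (use is_functorD[OF F] C sub(3-) subsetD[OF sub(1)] subsetD[OF sub(2)] in simp_all)

lemma is_functor_F_OMon_plus: "is_functor (restrict_functor F_OMon OMon_plus)"
proof (rule is_functor_restrict[OF is_functor_F_OMon category_OMon_plus])
qed (auto simp: F_OMon_def same_map_functor_def intro: OMon_plus_sub;
     simp add: OMon_plus_def OMon_def concrete_category_def)+

lemma is_functor_Fun_POMon_plus: "is_functor (restrict_functor (Fun_POMon S) OMon_plus)"
proof (rule is_functor_restrict[OF is_functor_Fun_POMon category_OMon_plus])
qed (auto simp: Fun_POMon_def fun_functor_def intro: OMon_plus_sub;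
     simp add: OMon_plus_def POMon_def concrete_category_def)+

text \<open>For nonempty \<open>S\<close> the structure \<open>M\<close> is recovered from \<open>Fun(S,M)\<close> through constant functions.\<close>

lemma PiE_const_eqD:
  fixes A B :: "'a set"
  assumes "S \<noteq> {}" "S \<rightarrow>\<^sub>E A = S \<rightarrow>\<^sub>E B"
  shows "A = B"
proof (rule Set.set_eqI)
  fix a
  have "a \<in> X \<longleftrightarrow> (\<lambda>s\<in>S. a) \<in> S \<rightarrow>\<^sub>E X" for X :: "'a set"
    using assms(1) by (auto simp: PiE_iff)
  from this[of A] this[of B] show "a \<in> A \<longleftrightarrow> a \<in> B"
    by (simp only: assms(2))
qed

lemma pointwise_eqD:
  assumes "S \<noteq> {}" "(\<lambda>f g. \<lambda>s\<in>S. F (f s) (g s)) = (\<lambda>f g. \<lambda>s\<in>S. G (f s) (g s))"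
  shows "F = G"
proof (intro ext)
  fix a b
  obtain s where "s \<in> S" using assms(1) by auto
  then show "F a b = G a b"
    using fun_cong[OF fun_cong[OF fun_cong[OF assms(2), of "\<lambda>_. a"], of "\<lambda>_. b"], of s] by simp
qed

lemma one_eqD: "S \<noteq> {} \<Longrightarrow> (\<lambda>s\<in>S. a) = (\<lambda>s\<in>S. b) \<Longrightarrow> a = b"
  by (metis (full_types) equals0I restrict_apply)

lemma fun_ord_monoid_inj:
  assumes "S \<noteq> {}" "po_monoid M" "po_monoid N" "fun_ord_monoid S M = fun_ord_monoid S N"
  shows "M = N"
proof -
  have c: "carrier M = carrier N" and m: "mult M = mult N" and o: "one M = one N"
    using PiE_const_eqD[OF assms(1), of "carrier M" "carrier N"]
      pointwise_eqD[OF assms(1), of "mult M" "mult N"] one_eqD[OF assms(1), of "one M" "one N"] assms(4)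
    by (simp_all add: fun_ord_monoid_def)
  have *: "ord_rel X = {(a, b). a \<in> carrier X \<and> b \<in> carrier X \<and> ((\<lambda>s\<in>S. a), (\<lambda>s\<in>S. b)) \<in> ord_rel (fun_ord_monoid S X)}"
    if "po_monoid X" for X
    using assms(1) po_monoid_ord_carrier[OF that] by auto
  have "ord_rel M = ord_rel N"
    by (simp only: *[OF assms(2)] *[OF assms(3)] assms(4) c)
  then show ?thesis using c m o by simp
qed

lemma fun_semiring_inj:
  assumes "S \<noteq> {}" "fun_semiring S M = fun_semiring S N"
  shows "M = N"
  using PiE_const_eqD[OF assms(1), of "carrier M" "carrier N"]
    pointwise_eqD[OF assms(1), of "mult M" "mult N"] pointwise_eqD[OF assms(1), of "sadd M" "sadd N"]
    one_eqD[OF assms(1), of "one M" "one N"] assms(2)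
  by (simp add: fun_semiring_def)

lemma F_Fun_obj_eq:
  assumes M: "M \<in> Obj OMon_plus"
  shows "F_Fun_obj S (fun_ord_monoid S M) = fun_semiring S (bipotent M)"
  unfolding F_Fun_obj_def
proof (rule the_equality)
  fix R assume "\<exists>M'\<in>Obj OMon_plus. fun_ord_monoid S M = fun_ord_monoid S M' \<and> R = fun_semiring S (bipotent M')"
  then obtain M' where M': "M' \<in> Obj OMon_plus" "fun_ord_monoid S M = fun_ord_monoid S M'"
      "R = fun_semiring S (bipotent M')" by auto
  show "R = fun_semiring S (bipotent M)"
  proof (cases "S = {}")
    case True then show ?thesis by (simp add: M'(3) fun_semiring_def restrict_def)
  next
    case False
    have "M = M'"
      using fun_ord_monoid_inj[OF False _ _ M'(2)] M M'(1) OMon_plus_sub(2)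
      by (auto simp: POMon_def concrete_category_simps)
    then show ?thesis using M'(3) by simp
  qed
qed (use M in auto)

lemma fun_functor_simps:
  "Src (fun_functor S C D \<Phi>) = C" "Tgt (fun_functor S C D \<Phi>) = D"
  "M \<in> Obj C \<Longrightarrow> fobj (fun_functor S C D \<Phi>) M = \<Phi> M"
  "(M, f, N) \<in> Arr C \<Longrightarrow> farr (fun_functor S C D \<Phi>) (M, f, N) =
     (\<Phi> M, \<lambda>h \<in> S \<rightarrow>\<^sub>E carrier M. compose S f h, \<Phi> N)"
  by (simp_all add: fun_functor_def)

lemma category_Fun_OMon_plus: "category (Fun_OMon_plus S :: ('s \<Rightarrow> 'a) ord_category)"
proof -
  let ?F = "restrict_functor (Fun_POMon S) (OMon_plus :: 'a ord_category)"
  have Src: "Src ?F = OMon_plus"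
    by (simp add: restrict_functor_def)
  have "inj_on (fobj ?F) (Obj OMon_plus) \<or> (\<forall>f\<in>Arr OMon_plus. \<forall>g\<in>Arr OMon_plus. farr ?F f = farr ?F g)"
  proof (cases "S = {}")
    case True
    have "farr ?F f = farr ?F g" if "f \<in> Arr OMon_plus" "g \<in> Arr OMon_plus" for f g
      using that that[THEN OMon_plus_sub(4)] True
      by (cases f; cases g)
        (simp add: restrict_functor_def Fun_POMon_def fun_functor_simps fun_ord_monoid_def restrict_def compose_def)
    then show ?thesis by blast
  next
    case False
    have "po_monoid M" if "M \<in> Obj OMon_plus" for M :: "'a ord_monoid"
      using OMon_plus_sub(2)[OF that] by (simp add: POMon_def concrete_category_simps)
    moreover have "fobj ?F M = fun_ord_monoid S M" if "M \<in> Obj OMon_plus" for M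
      using that OMon_plus_sub(2)[OF that] by (simp add: restrict_functor_def Fun_POMon_def fun_functor_simps)
    ultimately show ?thesis
      by (intro disjI1 inj_onI) (simp add: fun_ord_monoid_inj[OF False])
  qed
  then show ?thesis
    unfolding Fun_OMon_plus_def by (intro category_image[OF is_functor_Fun_POMon_plus]) (simp only: Src)
qed

lemma category_Fun_Semir_cat: "category (Fun_Semir_cat S :: ('s \<Rightarrow> 'a) semir_category)"
proof -
  let ?F = "Fun_Semir S :: ('a semiring_dag, _, ('s \<Rightarrow> 'a) semiring_dag, _) prefunctor"
  have Src: "Src ?F = Semir"
    by (simp add: Fun_Semir_def fun_functor_simps)
  have "inj_on (fobj ?F) (Obj Semir) \<or> (\<forall>f\<in>Arr Semir. \<forall>g\<in>Arr Semir. farr ?F f = farr ?F g)"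
  proof (cases "S = {}")
    case True
    have "farr ?F f = farr ?F g" if "f \<in> Arr Semir" "g \<in> Arr Semir" for f g
      using that True
      by (cases f; cases g)
        (simp add: Fun_Semir_def fun_functor_simps fun_semiring_def restrict_def compose_def)
    then show ?thesis by blast
  next
    case False
    have "inj_on (fobj ?F) (Obj Semir)"
      using fun_semiring_inj[OF False] by (auto simp: inj_on_def Fun_Semir_def fun_functor_simps)
    then show ?thesis ..
  qed
  then show ?thesis
    unfolding Fun_Semir_cat_def by (intro category_image[OF is_functor_Fun_Semir]) (simp only: Src)
qed

lemma is_functor_onto_Fun_OMon_plus:
    "is_functor (onto_image (restrict_functor (Fun_POMon S) OMon_plus))"
  and is_functor_onto_Fun_Semir_cat: "is_functor (onto_image (Fun_Semir S))"
  using is_functor_onto_image is_functor_Fun_POMon_plus is_functor_Fun_Semir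
    category_Fun_OMon_plus category_Fun_Semir_cat
  unfolding Fun_OMon_plus_def Fun_Semir_cat_def by blast+

lemma is_functor_F_Fun:
  "is_functor (F_Fun S ::
     (('s \<Rightarrow> 'a) ord_monoid, _, ('s \<Rightarrow> 'a) semiring_dag, _) prefunctor)"
proof -
  let ?C = "Fun_OMon_plus S :: ('s \<Rightarrow> 'a) ord_category"
    and ?D = "Fun_Semir_cat S :: ('s \<Rightarrow> 'a) semir_category"
  have ob: "\<exists>M \<in> Obj OMon_plus. N = fun_ord_monoid S M" if "N \<in> Obj ?C" for N
  proof -
    from that obtain M where "M \<in> Obj OMon_plus" "N = fobj (Fun_POMon S) M"
      by (auto simp: Fun_OMon_plus_def restrict_functor_def)
    then show ?thesis using OMon_plus_sub(2)[of M]
      by (auto simp: Fun_POMon_def fun_functor_simps)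
  qed
  have ar: "\<exists>M \<phi> N. (M, \<phi>, N) \<in> Arr OMon_plus \<and>
      x = (fun_ord_monoid S M, \<lambda>h \<in> S \<rightarrow>\<^sub>E carrier M. compose S \<phi> h, fun_ord_monoid S N)" if "x \<in> Arr ?C" for x
  proof -
    from that obtain m where m: "m \<in> Arr OMon_plus" "x = farr (Fun_POMon S) m"
      by (auto simp: Fun_OMon_plus_def restrict_functor_def)
    then show ?thesis using OMon_plus_sub(4)[OF m(1)]
      by (cases m) (auto simp: Fun_POMon_def fun_functor_simps)
  qed
  have C: "Dom ?C = Dom POMon" "Cod ?C = Cod POMon" "Id ?C = Id POMon" "Comp ?C = Comp POMon"
    by (simp_all add: Fun_OMon_plus_def restrict_functor_def Fun_POMon_def fun_functor_simps)
  have D: "Dom ?D = Dom Semir" "Cod ?D = Cod Semir" "Id ?D = Id Semir" "Comp ?D = Comp Semir"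
    by (simp_all add: Fun_Semir_cat_def Fun_Semir_def fun_functor_simps)
  have Src: "Src (Fun_Semir S :: ('a semiring_dag, _, ('s \<Rightarrow> 'a) semiring_dag, _) prefunctor) = Semir"
    by (simp add: Fun_Semir_def fun_functor_simps)
  have bo: "bipotent M \<in> Obj Semir" if "M \<in> Obj OMon_plus" for M :: "'a ord_monoid"
    using semiring_bipotent that cancel_to by (auto simp: Semir_def OMon_plus_def concrete_category_simps)
  have ba: "(bipotent M, \<phi>, bipotent N) \<in> Arr Semir" if "(M, \<phi>, N) \<in> Arr OMon_plus" for M N :: "'a ord_monoid" and \<phi>
    using that semiring_bipotent[of M] semiring_bipotent[of N] bipotent_map[of M N \<phi>]
      cancel_to[of M] cancel_to[of N]
    by (simp add: Semir_def OMon_plus_def concrete_category_simps)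
  have bD: "M \<in> Obj OMon_plus" "N \<in> Obj OMon_plus" if "(M, \<phi>, N) \<in> Arr OMon_plus" for M N :: "'a ord_monoid" and \<phi>
    using that by (auto simp: OMon_plus_def concrete_category_simps)
  show ?thesis
    unfolding F_Fun_def same_map_functor_def
  proof (rule is_functor_mkI[OF category_Fun_OMon_plus category_Fun_Semir_cat], goal_cases)
    case (1 A)
    then obtain M where M: "M \<in> Obj OMon_plus" "A = fun_ord_monoid S M" using ob by blast
    have "fobj (Fun_Semir S) (bipotent M) = fun_semiring S (bipotent M)"
      using bo[OF M(1)] by (simp add: Fun_Semir_def fun_functor_simps)
    then show ?case using M F_Fun_obj_eq[OF M(1)] bo[OF M(1)]
      by (auto simp: Fun_Semir_cat_def Fun_Semir_def fun_functor_simps image_iff intro!: bexI[of _ "bipotent M"])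
  next
    case (2 f)
    then obtain M \<phi> N where m: "(M, \<phi>, N) \<in> Arr OMon_plus"
      and f: "f = (fun_ord_monoid S M, \<lambda>h \<in> S \<rightarrow>\<^sub>E carrier M. compose S \<phi> h, fun_ord_monoid S N)"
      using ar by blast
    have "farr (Fun_Semir S) (bipotent M, \<phi>, bipotent N) =
        (fun_semiring S (bipotent M), \<lambda>h \<in> S \<rightarrow>\<^sub>E carrier M. compose S \<phi> h, fun_semiring S (bipotent N))"
      using ba[OF m] by (simp add: Fun_Semir_def fun_functor_simps)
    moreover have "farr (Fun_Semir S) (bipotent M, \<phi>, bipotent N) \<in> Arr ?D"
      using imageI[OF ba[OF m], of "farr (Fun_Semir S)"] Src by (simp add: Fun_Semir_cat_def)
    ultimately show ?case
      by (simp add: f F_Fun_obj_eq bD[OF m] C D)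
         (simp add: POMon_def Semir_def concrete_category_simps F_Fun_obj_eq bD[OF m])
  next
    case (3 A)
    then obtain M where M: "M \<in> Obj OMon_plus" "A = fun_ord_monoid S M" using ob by blast
    then show ?case
      by (simp add: C D) (simp add: POMon_def Semir_def concrete_category_simps F_Fun_obj_eq)
  next
    case (4 f g)
    from ar[OF 4(1)] obtain M \<phi> N where m: "(M, \<phi>, N) \<in> Arr OMon_plus"
      and f: "f = (fun_ord_monoid S M, \<lambda>h \<in> S \<rightarrow>\<^sub>E carrier M. compose S \<phi> h, fun_ord_monoid S N)"
      by blast
    obtain X g' Y where g: "g = (X, g', Y)" by (cases g)
    show ?case
      by (simp add: C D f g) (simp add: POMon_def Semir_def concrete_category_simps F_Fun_obj_eq bD[OF m])
  qed
qed

lemma composable: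
  "Tgt (onto_image (restrict_functor (Fun_POMon S) OMon_plus)) = Src (F_Fun S)"
  "Tgt (restrict_functor F_OMon OMon_plus) = Src (onto_image (Fun_Semir S))"
  by (simp_all add: onto_image_def F_Fun_def F_OMon_def same_map_functor_def Fun_OMon_plus_def
      restrict_functor_def Fun_Semir_def fun_functor_simps)

end

theory Submission
  imports Defs
begin

text \<open>Both composites send \<open>M\<close> to the functions from \<open>S\<close> to
  \<open>M\<close> with pointwise product and pointwise maximum, and an arrow \<phi> to
  postcomposition with \<phi>. On objects the point is that \<open>F_Fun_obj\<close> recovers this
  semiring from \<open>fun_ord_monoid S M\<close> (\<open>F_Fun_obj_eq\<close>); on arrows, that
  \<open>bipotent\<close> keeps carriers and maps. Functors being extensional records, it remains to
  compare sources and targets.\<close>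

lemma bipotent_Obj_Semir:
  "M \<in> Obj OMon_plus \<Longrightarrow> bipotent M \<in> Obj Semir"
  by (auto simp: Semir_def OMon_plus_def concrete_category_simps intro: semiring_bipotent cancel_to)

text \<open>A monotone map between total orders preserves maxima of pairs. The membership lets the
  arrow map of \<open>Fun_Semir S\<close> be evaluated, as it is \<open>undefined\<close> off
  \<open>Arr Semir\<close>.\<close>

lemma bipotent_Arr_Semir:
  "(M, \<phi>, N) \<in> Arr OMon_plus \<Longrightarrow> (bipotent M, \<phi>, bipotent N) \<in> Arr Semir"
  using semiring_bipotent[of M] semiring_bipotent[of N] bipotent_map[of M N \<phi>]
    cancel_to[of M] cancel_to[of N]
  by (simp add: Semir_def OMon_plus_def concrete_category_simps)

lemma Arr_OMon_plusD:
  "(M, \<phi>, N) \<in> Arr OMon_plus \<Longrightarrow> M \<in> Obj OMon_plus \<and> N \<in> Obj OMon_plus"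
  by (simp add: OMon_plus_def concrete_category_simps)

theorem proposition7p8:
  fixes S :: "'s set"
  shows "F_Fun S \<circ>\<^sub>F onto_image (restrict_functor (Fun_POMon S) OMon_plus) =
         onto_image (Fun_Semir S) \<circ>\<^sub>F restrict_functor F_OMon (OMon_plus :: 'a ord_category)"
proof -
  let ?P = "restrict_functor (Fun_POMon S) (OMon_plus :: 'a ord_category)"
  let ?B = "restrict_functor F_OMon (OMon_plus :: 'a ord_category)"
  have obj: "fobj (F_Fun S) (fobj ?P M) = fobj (Fun_Semir S) (fobj ?B M)"
    if M: "M \<in> Obj OMon_plus" for M
  proof -
    have P: "fobj ?P M = fun_ord_monoid S M"
      using M OMon_plus_sub(2)[OF M]
      by (simp add: restrict_functor_def Fun_POMon_def fun_functor_simps)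
    have B: "fobj ?B M = bipotent M"
      using M OMon_plus_sub(1)[OF M]
      by (simp add: restrict_functor_def F_OMon_def same_map_functor_def)
    \<comment> \<open>The object map of \<open>F_Fun S\<close> is restricted to this image category
      and unfolds only on its objects.\<close>
    have "fobj ?P M \<in> Obj (Fun_OMon_plus S)"
      using M by (simp add: Fun_OMon_plus_def restrict_functor_def)
    then show ?thesis
      using bipotent_Obj_Semir[OF M] F_Fun_obj_eq[OF M]
      by (simp add: P B F_Fun_def same_map_functor_def Fun_Semir_def fun_functor_simps)
  qed
  have arr: "farr (F_Fun S) (farr ?P f) = farr (Fun_Semir S) (farr ?B f)"
    if f: "f \<in> Arr OMon_plus" for f
  proof -
    obtain M \<phi> N where f_eq: "f = (M, \<phi>, N)" by (cases f)
    have m: "(M, \<phi>, N) \<in> Arr OMon_plus" using f by (simp add: f_eq)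
    have P: "farr ?P f = (fun_ord_monoid S M, \<lambda>h \<in> S \<rightarrow>\<^sub>E carrier M. compose S \<phi> h, fun_ord_monoid S N)"
      using m OMon_plus_sub(4)[OF m]
      by (simp add: f_eq restrict_functor_def Fun_POMon_def fun_functor_simps)
    have B: "farr ?B f = (bipotent M, \<phi>, bipotent N)"
      using m OMon_plus_sub(3)[OF m]
      by (simp add: f_eq restrict_functor_def F_OMon_def same_map_functor_def)
    have "farr ?P f \<in> Arr (Fun_OMon_plus S)"
      using f by (simp add: Fun_OMon_plus_def restrict_functor_def)
    \<comment> \<open>The two postcomposition maps are restricted to functions into these two
      carriers, so this identifies them.\<close>
    moreover have "carrier (bipotent M) = carrier M"
      by (simp add: bipotent_def)
    ultimately show ?thesis
      using bipotent_Arr_Semir[OF m] Arr_OMon_plusD[OF m]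
      by (simp add: P B F_Fun_obj_eq F_Fun_def same_map_functor_def Fun_Semir_def fun_functor_simps)
  qed
  have "Src ?P = OMon_plus" "Src ?B = OMon_plus"
    by (simp_all add: restrict_functor_def)
  \<comment> \<open>Equality of records includes the targets; \<open>onto_image\<close> alters
    nothing but the target, so \<open>obj\<close> and \<open>arr\<close> settle the rest.\<close>
  moreover have "Tgt (F_Fun S :: (('s \<Rightarrow> 'a) ord_monoid, _, ('s \<Rightarrow> 'a) semiring_dag, _) prefunctor)
      = image_category (Fun_Semir S)"
    by (simp add: F_Fun_def same_map_functor_def Fun_Semir_cat_def)
  ultimately show ?thesis
    unfolding comp_functor_def mk_functor_def
    by (auto simp: onto_image_def obj arr intro!: restrict_ext)
qed

end
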